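(* Let $Q=(q_0,q_1)\in(1,\infty)^2$ satisfy $q_0+q_1>q_0q_1$. Then the set $\mathcal{U}_Q$ of all $x\in I_Q=\left[0,\frac{1}{q_1-1}\right]$ having a unique $Q$-expansion is a Lebesgue null set.
   Context: For $Q=(q_0,q_1)\in(1,\infty)^2$, a $Q$-expansion of a real number $x$ is a sequence $(c_i)_{i\ge1}\in\{0,1\}^\infty$ such that $$x=\sum_{i=1}^{\infty}\frac{c_i}{q_{c_1}q_{c_2}\cdots q_{c_i}},$$ where $q_{c_j}$ equals $q_0$ if $c_j=0$ and $q_1$ if $c_j=1$. *)

theory Defs
  imports "HOL-Analysis.Analysis"
begin

definition base :: "real \<times> real \<Rightarrow> nat \<Rightarrow> real" where
  "base Q d = (if d = 0 then fst Q else snd Q)"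

text \<open>Digit sequences are indexed from 0, so \<open>c i\<close> is the digit written \<open>c\<^sub>i\<^sub>+\<^sub>1\<close> on paper
  and the \<open>i\<close>-th term has the denominator \<open>q\<^bsub>c 0\<^esub> \<cdots> q\<^bsub>c i\<^esub>\<close>.\<close>

definition is_expansion :: "real \<times> real \<Rightarrow> real \<Rightarrow> (nat \<Rightarrow> nat) \<Rightarrow> bool" where
  "is_expansion Q x c \<longleftrightarrow>
     (\<forall>i. c i \<in> {0, 1}) \<and> (\<lambda>i. real (c i) / (\<Prod>j\<le>i. base Q (c j))) sums x"

definition I_Q :: "real \<times> real \<Rightarrow> real set" where
  "I_Q Q = {0 .. 1 / (snd Q - 1)}"

definition univoque_set :: "real \<times> real \<Rightarrow> real set" where
  "univoque_set Q = {x \<in> I_Q Q. \<exists>!c. is_expansion Q x c}"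

end

theory Submission
  imports Defs
begin

text \<open>
  Prepending a digit \<open>d\<close> to an expansion of \<open>y\<close> gives an expansion of \<open>(y + d) / base Q d\<close>.
  The two resulting contractions map \<open>I_Q = [0, r]\<close>, with \<open>r = 1 / (q1 - 1)\<close>, onto \<open>[0, r / q0]\<close>
  and \<open>[1 / q1, r]\<close>, and the hypothesis \<open>q0 + q1 > q0 * q1\<close> says exactly that these two
  images overlap in an interval of positive length. A point of the overlap can start with either
  digit, so it has at least two expansions (\<open>multi_expansion_on_overlap\<close>).

  Now let \<open>x\<close> have a unique expansion, and follow its first \<open>n\<close> digits. The corresponding composition
  of contractions is an affine map \<open>z \<mapsto> a + k * z\<close> which sends \<open>I_Q\<close> to a short interval containing
  \<open>x\<close> (\<open>expansion_zoom\<close>). It sends the overlap to a subinterval consisting of points with two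
  expansions, and since the map is affine this subinterval fills a proportion of the short interval
  that depends neither on \<open>x\<close> nor on \<open>n\<close>. Thus every point of the univoque set lies in
  arbitrarily short intervals of which the set misses a fixed proportion.

  No set of positive measure can behave like this. That is Lebesgue's density theorem for measurable
  sets; \<open>negligible_if_proportional_holes\<close> proves it for arbitrary bounded sets from Vitali's
  covering theorem, so that the measurability of the univoque set is part of the conclusion.
\<close>

section \<open>Sets with holes of fixed proportion\<close>

text \<open>
  Let \<open>m\<close> be the outer measure of \<open>S\<close>. Inside any open \<open>G \<supseteq> S\<close>, Vitali's theorem selects disjoint
  balls that cover almost all of \<open>S\<close>. Together they have measure at least \<open>m\<close>, so their holes have
  measure at least \<open>\<theta> * m\<close>. Cutting the holes out still leaves a cover of almost all of \<open>S\<close>, which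
  again has measure at least \<open>m\<close>. Hence \<open>(1 + \<theta>) * m\<close> is at most the measure of \<open>G\<close>, which can be
  taken arbitrarily close to \<open>m\<close>; this forces \<open>m = 0\<close>.
\<close>

lemma negligible_if_proportional_holes:
  fixes S :: "'a::euclidean_space set"
  assumes "bounded S" and "0 < \<theta>"
    and holes: "\<And>x d. \<lbrakk>x \<in> S; 0 < d\<rbrakk> \<Longrightarrow> \<exists>a r H. 0 < r \<and> r < d \<and> x \<in> cball a r \<and>
      H \<in> lmeasurable \<and> H \<subseteq> cball a r \<and> H \<inter> S = {} \<and>
      \<theta> * measure lebesgue (cball a r) \<le> measure lebesgue H"
  shows "negligible S"
proof -
  let ?\<mu> = "measure lebesgue"
  define V where "V = {W \<in> lmeasurable. S \<subseteq> W}"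
  define m where "m = (INF W\<in>V. ?\<mu> W)"
  obtain R where "S \<subseteq> cball 0 R"
    using bounded_subset_ballD[OF \<open>bounded S\<close>, of 0] ball_subset_cball[of 0] by (metis subset_trans)
  then have "cball 0 R \<in> V"
    by (simp add: V_def)
  then have V_ne: "V \<noteq> {}"
    by auto
  have m_le: "m \<le> ?\<mu> W" if "W \<in> V" for W
    unfolding m_def by (rule cINF_lower[OF _ that]) (auto intro!: bdd_belowI[of _ 0])
  have m_ge0: "0 \<le> m"
    unfolding m_def by (rule cINF_greatest[OF V_ne]) simp
  have V_approx: "\<exists>W\<in>V. ?\<mu> W < c" if "m < c" for c
    using cInf_lessD[of "?\<mu> ` V" c] V_ne that unfolding m_def by auto
  have shrink: "(1 + \<theta>) * m \<le> ?\<mu> G" if "open G" "G \<in> lmeasurable" "S \<subseteq> G" for G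
  proof -
    define K where "K = {(a, r, H). 0 < r \<and> cball a r \<subseteq> G \<and>
      H \<in> lmeasurable \<and> H \<subseteq> cball a r \<and> H \<inter> S = {} \<and> \<theta> * ?\<mu> (cball a r) \<le> ?\<mu> H}"
    define ctr :: "'a \<times> real \<times> 'a set \<Rightarrow> 'a" where "ctr = fst"
    define rad :: "'a \<times> real \<times> 'a set \<Rightarrow> real" where "rad = (\<lambda>i. fst (snd i))"
    define hole :: "'a \<times> real \<times> 'a set \<Rightarrow> 'a set" where "hole = (\<lambda>i. snd (snd i))"
    let ?B = "\<lambda>i. cball (ctr i) (rad i)"
    have K: "0 < rad i" "?B i \<subseteq> G" "hole i \<in> lmeasurable" "hole i \<subseteq> ?B i" "hole i \<inter> S = {}"
      "\<theta> * ?\<mu> (?B i) \<le> ?\<mu> (hole i)" if "i \<in> K" for i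
      using that by (auto simp: K_def ctr_def rad_def hole_def)
    \<comment> \<open>A ball through \<open>x\<close> of radius below \<open>e / 2\<close> lies in \<open>ball x e\<close>, wherever its centre is.\<close>
    have fine: "\<exists>i. i \<in> K \<and> x \<in> ?B i \<and> rad i < d" if "x \<in> S" "0 < d" for x d
    proof -
      obtain e where e: "0 < e" "ball x e \<subseteq> G"
        using \<open>open G\<close> \<open>S \<subseteq> G\<close> \<open>x \<in> S\<close> by (meson openE subsetD)
      obtain a r H where arH: "0 < r" "r < min d (e / 2)" "x \<in> cball a r" "H \<in> lmeasurable"
        "H \<subseteq> cball a r" "H \<inter> S = {}" "\<theta> * ?\<mu> (cball a r) \<le> ?\<mu> H"
        using holes[OF \<open>x \<in> S\<close>, of "min d (e / 2)"] \<open>0 < d\<close> e(1) by auto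
      have "cball a r \<subseteq> ball x e"
      proof
        fix y assume "y \<in> cball a r"
        then show "y \<in> ball x e"
          using arH(2,3) dist_triangle2[of x y a] by (auto simp: dist_commute)
      qed
      then have "(a, r, H) \<in> K"
        using arH e(2) by (auto simp: K_def)
      then show ?thesis
        using arH by (intro exI[of _ "(a, r, H)"]) (auto simp: ctr_def rad_def)
    qed
    obtain C where C: "countable C" "C \<subseteq> K"
      "pairwise (\<lambda>i j. disjnt (?B i) (?B j)) C" "negligible (S - (\<Union>i\<in>C. ?B i))"
      using Vitali_covering_theorem_cballs[of K rad S ctr, OF K(1) fine] by blast
    let ?U = "\<Union>i\<in>C. ?B i" and ?H = "\<Union>i\<in>C. hole i"
    have disjB: "disjoint_family_on ?B C"
      using C(3) by (auto simp: disjoint_family_on_def pairwise_def disjnt_def)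
    have disjH: "disjoint_family_on hole C"
      using disjB C(2) K(4) unfolding disjoint_family_on_def by blast
    have BG: "?B i \<subseteq> G" if "i \<in> C" for i
      using C(2) K(2) that by blast
    have U: "?U \<in> lmeasurable"
      by (rule fmeasurable_UN[OF C(1) _ _ \<open>G \<in> lmeasurable\<close>]) (use BG in simp_all)
    have H: "?H \<in> lmeasurable"
    proof (rule fmeasurable_UN[OF C(1) _ _ \<open>G \<in> lmeasurable\<close>])
      fix i assume "i \<in> C"
      then have "i \<in> K"
        using C(2) by auto
      then show "hole i \<subseteq> G" "hole i \<in> sets lebesgue"
        using K(2)[of i] K(4)[of i] fmeasurableD[OF K(3)[of i]] by auto
    qed
    have HU: "?H \<subseteq> ?U"
      using C(2) K(4) by blast
    have "ennreal \<theta> * emeasure lebesgue ?U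
        = (\<integral>\<^sup>+i. ennreal \<theta> * emeasure lebesgue (?B i) \<partial>count_space C)"
      by (subst emeasure_UN_countable[OF _ C(1) disjB]) (auto simp: nn_integral_cmult)
    also have "\<dots> \<le> (\<integral>\<^sup>+i. emeasure lebesgue (hole i) \<partial>count_space C)"
    proof (rule nn_integral_mono)
      fix i assume "i \<in> space (count_space C)"
      then have "i \<in> K" using C(2) by auto
      have "ennreal (\<theta> * ?\<mu> (?B i)) \<le> ennreal (?\<mu> (hole i))"
        using K(6)[OF \<open>i \<in> K\<close>] by (rule ennreal_leI)
      then show "ennreal \<theta> * emeasure lebesgue (?B i) \<le> emeasure lebesgue (hole i)"
        using K(3)[OF \<open>i \<in> K\<close>] \<open>0 < \<theta>\<close>
        by (simp add: emeasure_eq_measure2 ennreal_mult lmeasurable_cball)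
    qed
    also have "\<dots> = emeasure lebesgue ?H"
      by (rule emeasure_UN_countable[OF _ C(1) disjH, symmetric])
        (use C(2) K(3) in \<open>auto intro: fmeasurableD\<close>)
    finally have HB: "\<theta> * ?\<mu> ?U \<le> ?\<mu> ?H"
      using U H \<open>0 < \<theta>\<close> by (simp add: emeasure_eq_measure2 flip: ennreal_mult)
    have N: "S - ?U \<in> lmeasurable" "?\<mu> (S - ?U) = 0"
      using C(4) negligible_imp_measurable negligible_imp_measure0 by auto
    have "m \<le> ?\<mu> ((S - ?U) \<union> (?U - ?H))"
    proof (rule m_le)
      have "S \<subseteq> (S - ?U) \<union> (?U - ?H)"
        using C(2) K(5) by blast
      then show "(S - ?U) \<union> (?U - ?H) \<in> V"
        using fmeasurable.Un[OF N(1) fmeasurable_Diff[OF U fmeasurableD[OF H]]] by (simp add: V_def)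
    qed
    also have "\<dots> \<le> ?\<mu> (?U - ?H)"
      using measure_Un_le[of "S - ?U" lebesgue "?U - ?H"] N U H by (simp add: fmeasurableD)
    also have "\<dots> = ?\<mu> ?U - ?\<mu> ?H"
      by (rule measurable_measure_Diff) (use U H HU in \<open>auto intro: fmeasurableD\<close>)
    finally have "m \<le> ?\<mu> ?U - ?\<mu> ?H" .
    moreover have "?\<mu> ?U \<le> ?\<mu> G"
      by (rule measure_mono_fmeasurable) (use BG U that in \<open>blast intro: fmeasurableD\<close>)+
    moreover have "\<theta> * m \<le> \<theta> * ?\<mu> ?U"
      using \<open>m \<le> ?\<mu> ?U - ?\<mu> ?H\<close> \<open>0 < \<theta>\<close> measure_nonneg[of lebesgue ?H]
      by (intro mult_left_mono) linarith+
    ultimately show ?thesis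
      using HB by (simp add: algebra_simps)
  qed
  have "m = 0"
  proof (rule ccontr)
    assume "m \<noteq> 0"
    then have "m < (1 + \<theta>) * m"
      using m_ge0 \<open>0 < \<theta>\<close> by simp
    then obtain W where W: "W \<in> V" "?\<mu> W < (1 + \<theta>) * m"
      using V_approx by blast
    define \<epsilon> where "\<epsilon> = (1 + \<theta>) * m - ?\<mu> W"
    have "0 < \<epsilon>"
      using W by (simp add: \<epsilon>_def)
    have W_meas: "W \<in> lmeasurable" "S \<subseteq> W"
      using W(1) by (auto simp: V_def)
    obtain G where G: "open G" "W \<subseteq> G" "G - W \<in> lmeasurable"
      "emeasure lebesgue (G - W) < ennreal \<epsilon>"
      using sets_lebesgue_outer_open[OF fmeasurableD[OF W_meas(1)] \<open>0 < \<epsilon>\<close>] .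
    have G_eq: "G = W \<union> (G - W)"
      using G(2) by blast
    have "G \<in> lmeasurable"
      using fmeasurable.Un[OF W_meas(1) G(3)] G_eq by simp
    have "?\<mu> (G - W) < \<epsilon>"
      using G(3,4) by (simp add: emeasure_eq_measure2 ennreal_less_iff)
    moreover have "?\<mu> G \<le> ?\<mu> W + ?\<mu> (G - W)"
      using measure_Un_le[OF fmeasurableD[OF W_meas(1)] fmeasurableD[OF G(3)]] G_eq by simp
    moreover have "(1 + \<theta>) * m \<le> ?\<mu> G"
      using shrink[OF G(1) \<open>G \<in> lmeasurable\<close>] G(2) W_meas(2) by blast
    ultimately show False
      by (simp add: \<epsilon>_def)
  qed
  show ?thesis
    unfolding negligible_outer_le
  proof (intro allI impI)
    fix e :: real assume "0 < e"
    then show "\<exists>T. S \<subseteq> T \<and> T \<in> lmeasurable \<and> ?\<mu> T \<le> e"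
      using V_approx[of e] \<open>m = 0\<close> by (auto simp: V_def intro: less_imp_le)
  qed
qed

section \<open>Digit expansions\<close>

lemma is_expansion_case_nat:
  assumes "is_expansion Q y c" and "d \<in> {0, 1}"
  shows "is_expansion Q ((y + real d) / base Q d) (case_nat d c)"
proof -
  let ?t = "\<lambda>c i. real (c i) / (\<Prod>j\<le>i. base Q (c j))"
  have "?t c sums y"
    using assms(1) by (simp add: is_expansion_def)
  then have "(\<lambda>i. ?t c i / base Q d) sums (y / base Q d)"
    by (rule sums_divide)
  moreover have "?t (case_nat d c) (Suc i) = ?t c i / base Q d" for i
    by (simp add: prod.atMost_Suc_shift del: prod.atMost_Suc)
  ultimately have "(\<lambda>i. ?t (case_nat d c) (Suc i)) sums (y / base Q d)"
    by presburger
  then have "?t (case_nat d c) sums (y / base Q d + ?t (case_nat d c) 0)"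
    by (rule sums_Suc)
  moreover have "\<forall>i. case_nat d c i \<in> {0, 1}"
    using assms by (auto simp: is_expansion_def split: nat.split)
  ultimately show ?thesis
    by (simp add: is_expansion_def add_divide_distrib)
qed

lemma is_expansion_tail:
  assumes "is_expansion Q x c" and "fst Q \<noteq> 0" and "snd Q \<noteq> 0"
  shows "is_expansion Q (base Q (c 0) * x - real (c 0)) (\<lambda>i. c (Suc i))"
proof -
  let ?b = "base Q (c 0)"
  have b: "?b \<noteq> 0"
    using assms by (simp add: base_def)
  have "(\<lambda>i. real (c (Suc i)) / (\<Prod>j\<le>Suc i. base Q (c j))) sums (x - real (c 0) / ?b)"
    using assms(1) by (subst sums_Suc_iff) (simp add: is_expansion_def)
  from sums_mult[OF this, of ?b] b show ?thesis
    using assms(1)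
    by (simp add: is_expansion_def prod.atMost_Suc_shift right_diff_distrib del: prod.atMost_Suc)
qed

locale expansion_bases =
  fixes q0 q1 :: real
  assumes q0: "q0 > 1" and q1: "q1 > 1"
begin

abbreviation Q :: "real \<times> real" where "Q \<equiv> (q0, q1)"

definition top_value :: real where "top_value = 1 / (q1 - 1)"

lemma top_value_pos: "0 < top_value"
  using q1 by (simp add: top_value_def)

lemma top_value_fixed: "q1 * top_value - 1 = top_value"
  using q1 by (simp add: top_value_def field_simps)

lemma I_Q_eq: "I_Q Q = {0..top_value}"
  by (simp add: I_Q_def top_value_def)

lemma base_gt_1: "1 < base Q d"
  using q0 q1 by (simp add: base_def)

text \<open>
  The upper bound comes from the potential \<open>top_value / P n\<close>, where \<open>P n\<close> is the product of the
  first \<open>n\<close> bases: a digit 1 lowers it by exactly the term it contributes to the sum, a digit 0 lowers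
  it and contributes nothing. So the partial sum plus the potential never increases.
\<close>

lemma expansion_value_in_I_Q:
  assumes "is_expansion Q x c"
  shows "x \<in> I_Q Q"
proof -
  let ?P = "\<lambda>n. \<Prod>j<n. base Q (c j)"
  let ?t = "\<lambda>i. real (c i) / (\<Prod>j\<le>i. base Q (c j))"
  have P_pos: "0 < ?P n" for n
    by (intro prod_pos) (use base_gt_1 in \<open>auto intro: less_trans[OF zero_less_one]\<close>)
  have sums: "?t sums x" and digits: "\<And>i. c i = 0 \<or> c i = 1"
    using assms by (auto simp: is_expansion_def)
  have t_eq: "?t i = real (c i) / ?P (Suc i)" for i
    by (simp add: lessThan_Suc_atMost)
  have partial: "(\<Sum>i<n. ?t i) + top_value / ?P n \<le> top_value" for n
  proof (induction n)
    case (Suc n)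
    have "real (c n) / ?P (Suc n) + top_value / ?P (Suc n) \<le> top_value / ?P n"
    proof -
      have "real (c n) + top_value \<le> base Q (c n) * top_value"
        using digits[of n] top_value_fixed q0 top_value_pos by (auto simp: base_def)
      then have "(real (c n) + top_value) / ?P (Suc n) \<le> (base Q (c n) * top_value) / ?P (Suc n)"
        using P_pos[of "Suc n"] by (intro divide_right_mono) auto
      also have "\<dots> = top_value / ?P n"
        using base_gt_1[of "c n"] by simp
      finally show ?thesis
        by (simp only: add_divide_distrib)
    qed
    then show ?case
      using Suc t_eq[of n] unfolding sum.lessThan_Suc by linarith
  qed simp
  have partial_le: "(\<Sum>i<n. ?t i) \<le> top_value" for n
    using partial[of n] divide_pos_pos[OF top_value_pos P_pos[of n]] by linarith
  have "x \<le> top_value"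
    using sums unfolding sums_def by (rule LIMSEQ_le_const2) (use partial_le in auto)
  moreover have "0 \<le> ?t i" for i
    unfolding t_eq using P_pos[of "Suc i"] by (intro divide_nonneg_pos) auto
  then have "0 \<le> x"
    using sums sums_le[of "\<lambda>_. 0" ?t 0 x] sums_zero by auto
  ultimately show ?thesis
    by (simp add: I_Q_eq)
qed

end

locale overlapping_bases = expansion_bases +
  assumes overlap: "q0 + q1 > q0 * q1"
begin

lemma overlap_nonempty: "1 / q1 < top_value / q0"
  using q0 q1 overlap by (simp add: top_value_def field_simps)

text \<open>
  The greedy algorithm: use the digit 1 whenever \<open>z \<ge> 1 / q1\<close>, and replace \<open>z\<close> by the value that the
  remaining digits have to represent. Because the images of \<open>I_Q\<close> under the two digit maps leave no
  gap, this value stays in \<open>I_Q\<close>, so the error after \<open>n\<close> digits is bounded by a geometric sequence.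
\<close>

lemma exists_expansion:
  assumes "y \<in> I_Q Q"
  shows "\<exists>c. is_expansion Q y c"
proof -
  define dig :: "real \<Rightarrow> nat" where "dig z = (if 1 / q1 \<le> z then 1 else 0)" for z
  define T where "T z = base Q (dig z) * z - real (dig z)" for z
  define z where "z n = (T ^^ n) y" for n
  define c where "c n = dig (z n)" for n
  let ?P = "\<lambda>n. \<Prod>j<n. base Q (c j)"
  have T_inv: "T v \<in> {0..top_value}" if "v \<in> {0..top_value}" for v
  proof (cases "1 / q1 \<le> v")
    case True
    have "q1 * v \<le> q1 * top_value"
      using that q1 by (intro mult_left_mono) auto
    moreover have "1 \<le> q1 * v"
      using True q1 by (simp add: field_simps)
    ultimately have "q1 * v - 1 \<in> {0..top_value}"
      using top_value_fixed unfolding atLeastAtMost_iff by linarith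
    then show ?thesis
      using True by (simp add: T_def dig_def base_def)
  next
    case False
    then have "q0 * v \<le> q0 * (top_value / q0)"
      using overlap_nonempty q0 by (intro mult_left_mono) auto
    then show ?thesis
      using False that q0 by (auto simp: T_def dig_def base_def)
  qed
  have z_Suc: "z (Suc n) = base Q (c n) * z n - real (c n)" for n
    by (simp add: z_def c_def T_def)
  have z_range: "z n \<in> {0..top_value}" for n
  proof (induction n)
    case 0
    then show ?case using assms by (simp add: z_def I_Q_eq)
  next
    case (Suc n)
    then show ?case using T_inv[of "z n"] by (simp add: z_def)
  qed
  have P_pos: "0 < ?P n" for n
    by (intro prod_pos) (use base_gt_1 in \<open>auto intro: less_trans[OF zero_less_one]\<close>)
  define \<rho> where "\<rho> = min q0 q1"
  have "1 < \<rho>"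
    using q0 q1 by (simp add: \<rho>_def)
  have P_ge: "\<rho> ^ n \<le> ?P n" for n
    using prod_mono[of "{..<n}" "\<lambda>_. \<rho>" "\<lambda>j. base Q (c j)"] \<open>1 < \<rho>\<close>
    by (simp add: \<rho>_def base_def)
  have remainder: "(\<Sum>i<n. real (c i) / (\<Prod>j\<le>i. base Q (c j))) = y - z n / ?P n" for n
  proof (induction n)
    case 0
    then show ?case by (simp add: z_def)
  next
    case (Suc n)
    have "real (c n) / ?P (Suc n) = z n / ?P n - z (Suc n) / ?P (Suc n)"
      using base_gt_1[of "c n"] by (simp add: z_Suc diff_divide_distrib)
    then show ?case
      using Suc by (simp add: lessThan_Suc_atMost[symmetric] del: prod.lessThan_Suc)
  qed
  have "(\<lambda>n. z n / ?P n) \<longlonglongrightarrow> 0"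
  proof (rule tendsto_sandwich[of "\<lambda>_. 0" _ _ "\<lambda>n. top_value * (1 / \<rho>) ^ n"])
    show "\<forall>\<^sub>F n in sequentially. 0 \<le> z n / ?P n"
      using z_range P_pos by (auto intro!: always_eventually divide_nonneg_pos)
    show "\<forall>\<^sub>F n in sequentially. z n / ?P n \<le> top_value * (1 / \<rho>) ^ n"
      using z_range P_ge \<open>1 < \<rho>\<close> top_value_pos
      by (auto intro!: always_eventually frac_le simp: power_divide)
    show "(\<lambda>n. top_value * (1 / \<rho>) ^ n) \<longlonglongrightarrow> 0"
      using \<open>1 < \<rho>\<close> by (intro tendsto_mult_right_zero LIMSEQ_power_zero) auto
  qed simp
  then have "(\<lambda>n. y - z n / ?P n) \<longlonglongrightarrow> y - 0"
    by (intro tendsto_diff tendsto_const)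
  then have "(\<lambda>i. real (c i) / (\<Prod>j\<le>i. base Q (c j))) sums y"
    by (simp add: sums_def remainder)
  then have "is_expansion Q y c"
    by (simp add: is_expansion_def c_def dig_def)
  then show ?thesis
    by blast
qed

section \<open>Points with several expansions\<close>

definition multi_expansion :: "real \<Rightarrow> bool" where
  "multi_expansion x \<longleftrightarrow> (\<exists>c c'. is_expansion Q x c \<and> is_expansion Q x c' \<and> c \<noteq> c')"

lemma univoque_setD:
  assumes "x \<in> univoque_set Q"
  shows "\<not> multi_expansion x"
  using assms by (auto simp: univoque_set_def multi_expansion_def)

lemma multi_expansion_on_overlap:
  assumes "y \<in> {1 / q1 .. top_value / q0}"
  shows "multi_expansion y"
proof -
  have "0 < 1 / q1"
    using q1 by simp
  then have "0 < y"
    using assms unfolding atLeastAtMost_iff by linarith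
  have "q0 * y \<le> q0 * (top_value / q0)"
    using assms q0 by (intro mult_left_mono) auto
  then have "q0 * y \<in> I_Q Q"
    using \<open>0 < y\<close> q0 by (simp add: I_Q_eq)
  then obtain c where "is_expansion Q (q0 * y) c"
    using exists_expansion by blast
  from is_expansion_case_nat[OF this, of 0] have c: "is_expansion Q y (case_nat 0 c)"
    using q0 by (simp add: base_def)
  have "top_value / q0 \<le> top_value"
    using q0 top_value_pos by (simp add: field_simps)
  then have "q1 * y \<le> q1 * top_value"
    using assms q1 by (intro mult_left_mono) auto
  moreover have "1 \<le> q1 * y"
    using assms q1 by (simp add: field_simps)
  ultimately have "q1 * y - 1 \<in> I_Q Q"
    using top_value_fixed unfolding I_Q_eq atLeastAtMost_iff by linarith
  then obtain c' where "is_expansion Q (q1 * y - 1) c'"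
    using exists_expansion by blast
  from is_expansion_case_nat[OF this, of 1] have c': "is_expansion Q y (case_nat 1 c')"
    using q1 by (simp add: base_def)
  have "case_nat 0 c \<noteq> case_nat 1 c'"
    by (metis old.nat.simps(4) zero_neq_one)
  with c c' show ?thesis
    unfolding multi_expansion_def by blast
qed

lemma multi_expansion_prepend:
  assumes "multi_expansion y" and "d \<in> {0, 1}"
  shows "multi_expansion ((y + real d) / base Q d)"
proof -
  obtain c c' where cc': "is_expansion Q y c" "is_expansion Q y c'" "c \<noteq> c'"
    using assms(1) by (auto simp: multi_expansion_def)
  have "case_nat d c \<noteq> case_nat d c'"
  proof
    assume eq: "case_nat d c = case_nat d c'"
    have "c i = c' i" for i
      using fun_cong[OF eq, of "Suc i"] by simp
    with \<open>c \<noteq> c'\<close> show False by auto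
  qed
  with cc' is_expansion_case_nat[OF _ assms(2)] show ?thesis
    unfolding multi_expansion_def by blast
qed

text \<open>
  Here \<open>z \<mapsto> a + k * z\<close> is the effect of prepending the first \<open>n\<close> digits of \<open>c\<close>, and \<open>y\<close> is the value of
  the remaining digits. The zoom argument uses two features of this map: it contracts geometrically in \<open>n\<close>, and
  it preserves the existence of two expansions.
\<close>

lemma expansion_zoom:
  assumes "is_expansion Q x c"
  shows "\<exists>a k y. 0 < k \<and> k \<le> (1 / min q0 q1) ^ n \<and> y \<in> I_Q Q \<and> x = a + k * y \<and>
    (\<forall>z. multi_expansion z \<longrightarrow> multi_expansion (a + k * z))"
  using assms
proof (induction n arbitrary: x c)
  case 0
  from expansion_value_in_I_Q[OF this] show ?case
    by - (rule exI[of _ 0], rule exI[of _ 1], rule exI[of _ x], simp)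
next
  case (Suc n)
  let ?d = "c 0" and ?b = "base Q (c 0)"
  have d: "?d \<in> {0, 1}"
    using Suc.prems by (auto simp: is_expansion_def)
  have b: "0 < ?b" "1 / ?b \<le> 1 / min q0 q1"
    using q0 q1 by (auto simp: base_def intro!: divide_left_mono)
  obtain a k y where IH: "0 < k" "k \<le> (1 / min q0 q1) ^ n" "y \<in> I_Q Q"
    "?b * x - real ?d = a + k * y" "\<And>z. multi_expansion z \<Longrightarrow> multi_expansion (a + k * z)"
    using Suc.IH[OF is_expansion_tail[OF Suc.prems]] q0 q1 by auto
  have affine: "(a + real ?d) / ?b + k * z / ?b = (a + k * z + real ?d) / ?b" for z
    by (simp add: add_divide_distrib)
  have "k * (1 / ?b) \<le> (1 / min q0 q1) ^ n * (1 / min q0 q1)"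
    using IH b q0 q1 by (intro mult_mono) auto
  then have "k / ?b \<le> (1 / min q0 q1) ^ Suc n"
    by (simp add: mult.commute)
  moreover have "x = (a + k * y + real ?d) / ?b"
    using IH(4) b by (simp add: field_simps)
  ultimately show ?case
    using IH b multi_expansion_prepend[OF IH(5) d]
    by - (rule exI[of _ "(a + real ?d) / ?b"], rule exI[of _ "k / ?b"], rule exI[of _ y],
      simp add: affine)
qed

section \<open>The univoque set is null\<close>

lemma negligible_univoque_set: "negligible (univoque_set Q)"
proof -
  \<comment> \<open>The proportion of \<open>I_Q\<close> that the overlap fills; affine maps preserve it.\<close>
  define \<theta> where "\<theta> = (top_value / q0 - 1 / q1) / top_value"
  have "0 < \<theta>"
    using overlap_nonempty top_value_pos by (simp add: \<theta>_def)
  show ?thesis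
  proof (rule negligible_if_proportional_holes[OF _ \<open>0 < \<theta>\<close>])
    show "bounded (univoque_set Q)"
      by (rule bounded_subset[of "I_Q Q"]) (auto simp: I_Q_eq univoque_set_def)
  next
    fix x d :: real
    assume x: "x \<in> univoque_set Q" and "0 < d"
    then obtain c where c: "is_expansion Q x c"
      by (auto simp: univoque_set_def)
    have "1 / min q0 q1 < 1"
      using q0 q1 by simp
    then obtain n where n: "(1 / min q0 q1) ^ n < d / top_value"
      using real_arch_pow_inv[of "d / top_value" "1 / min q0 q1"] \<open>0 < d\<close> top_value_pos by auto
    obtain a k y where zoom: "0 < k" "k \<le> (1 / min q0 q1) ^ n" "y \<in> I_Q Q" "x = a + k * y"
      "\<And>z. multi_expansion z \<Longrightarrow> multi_expansion (a + k * z)"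
      using expansion_zoom[OF c, of n] by blast
    define r where "r = k * top_value / 2"
    define H where "H = {a + k * (1 / q1) .. a + k * (top_value / q0)}"
    have "0 < r"
      using zoom(1) top_value_pos by (simp add: r_def)
    have "k < d / top_value"
      using zoom(2) n by linarith
    then have "r < d"
      using \<open>0 < r\<close> top_value_pos by (simp add: r_def field_simps)
    \<comment> \<open>The ball below is the image of \<open>I_Q\<close> under the zoom map, and \<open>H\<close> is the image of the overlap.\<close>
    have ball: "cball (a + r) r = {a .. a + k * top_value}"
      by (simp add: cball_eq_atLeastAtMost r_def)
    have "H \<inter> univoque_set Q = {}"
    proof -
      have "multi_expansion w" if "w \<in> H" for w
      proof -
        have "(w - a) / k \<in> {1 / q1 .. top_value / q0}"
          using that zoom(1) q0 q1 by (auto simp: H_def field_simps)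
        from zoom(5)[OF multi_expansion_on_overlap[OF this]] show ?thesis
          using zoom(1) by simp
      qed
      then show ?thesis
        using univoque_setD by blast
    qed
    moreover have "x \<in> cball (a + r) r"
      using zoom by (auto simp: ball I_Q_eq)
    moreover have "H \<subseteq> cball (a + r) r"
    proof -
      have "0 < k * (1 / q1)"
        using zoom(1) q1 by simp
      moreover have "k * (top_value / q0) \<le> k * top_value"
        using zoom(1) q0 top_value_pos by (intro mult_left_mono) (auto simp: field_simps)
      ultimately show ?thesis
        unfolding ball H_def by auto
    qed
    moreover have "\<theta> * measure lebesgue (cball (a + r) r) \<le> measure lebesgue H"
    proof -
      have "measure lebesgue H = k * (top_value / q0 - 1 / q1)"
        using mult_left_mono[of "1 / q1" "top_value / q0" k] overlap_nonempty zoom(1)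
        by (simp add: H_def right_diff_distrib)
      moreover have "measure lebesgue (cball (a + r) r) = k * top_value"
        using zoom(1) top_value_pos by (simp add: ball)
      ultimately show ?thesis
        using top_value_pos by (simp add: \<theta>_def)
    qed
    moreover have "H \<in> lmeasurable"
      by (simp add: H_def)
    ultimately show "\<exists>a r H. 0 < r \<and> r < d \<and> x \<in> cball a r \<and> H \<in> lmeasurable \<and>
        H \<subseteq> cball a r \<and> H \<inter> univoque_set Q = {} \<and>
        \<theta> * measure lebesgue (cball a r) \<le> measure lebesgue H"
      using \<open>0 < r\<close> \<open>r < d\<close> by blast
  qed
qed

end

theorem theorem1p4:
  fixes q0 q1 :: real
  assumes "q0 > 1" and "q1 > 1"
    and "q0 + q1 > q0 * q1"
  shows "univoque_set (q0, q1) \<in> null_sets lebesgue"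
proof -
  interpret overlapping_bases q0 q1
    using assms by unfold_locales
  show ?thesis
    using negligible_univoque_set by (simp add: negligible_iff_null_sets)
qed

end
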